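(* Let $t\in\mathbb{R}$ with $t<0$. Then every hypercomplex number $h\in\mathbb{H}_t$ is similar to its $t$-spectral value $(\sigma_t(h),0)\in\mathbb{H}_t$, in the sense that the matrices $[h]_t$ and $\Sigma_t(h)$ are similar in $\mathcal{H}_2^t$.
   Context: For $t\in\mathbb{R}$, $\mathbb{H}_t$ is the set $\mathbb{C}^2$ with usual addition and multiplication $(a_1,b_1)\cdot_t(a_2,b_2)=(a_1a_2+tb_1\overline{b_2},\;a_1b_2+b_1\overline{a_2})$. The realization of $(a,b)\in\mathbb{H}_t$ is $[(a,b)]_t=\begin{pmatrix} a & tb\\ \overline{b} & \overline{a}\end{pmatrix}\in M_2(\mathbb{C})$, and $\mathcal{H}_2^t=\{[\xi]_t:\xi\in\mathbb{H}_t\}$. For $(a,b)\in\mathbb{H}_t$ with $a=x+yi$, $b=u+vi$ ($x,y,u,v\in\mathbb{R}$), the $t$-spectral value is $\sigma_t((a,b))=a$ if $b=0$, and $\sigma_t((a,b))=x+i\sqrt{y^2-tu^2-tv^2}$ if $b\neq0$ (for $t<0$ the radicand is nonnegative and the square root is the nonnegative one). The $t$-spectral form of $h\in\mathbb{H}_t$, for $t<0$, is $\Sigma_t(h)=\begin{pmatrix}\sigma_t(h)&0\\0&\overline{\sigma_t(h)}\end{pmatrix}=[(\sigma_t(h),0)]_t\in\mathcal{H}_2^t$. Two matrices $A,B\in\mathcal{H}_2^t$ are similar in $\mathcal{H}_2^t$ if there exists an invertible $U\in\mathcal{H}_2^t$ such that $B=U^{-1}AU$ in $\mathcal{H}_2^t$;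 two elements of $\mathbb{H}_t$ are called similar if their realizations are similar in $\mathcal{H}_2^t$. *)

theory Defs
  imports "HOL-Analysis.Analysis"
begin

(* The underlying set of H_t is C^2 with componentwise addition, for every t; the product
   type carries exactly this addition. Only the multiplication depends on t. *)
type_synonym hypercomplex = "complex \<times> complex"

definition hyp_mult :: "real \<Rightarrow> hypercomplex \<Rightarrow> hypercomplex \<Rightarrow> hypercomplex" where
  "hyp_mult t h k =
     (fst h * fst k + of_real t * snd h * cnj (snd k), fst h * snd k + snd h * cnj (fst k))"

definition realization :: "real \<Rightarrow> hypercomplex \<Rightarrow> complex^2^2" where
  "realization t h =
     vector [vector [fst h,       of_real t * snd h],
             vector [cnj (snd h), cnj (fst h)]]"

definition H2 :: "real \<Rightarrow> (complex^2^2) set" where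
  "H2 t = range (realization t)"

(* csqrt is the principal complex square root, so the definition also makes sense when t > 0
   and the radicand is negative; on nonnegative reals it is the nonnegative real root. *)
definition spectral_value :: "real \<Rightarrow> hypercomplex \<Rightarrow> complex" where
  "spectral_value t h =
     (let a = fst h; b = snd h in
      if b = 0 then a
      else of_real (Re a) +
           \<i> * csqrt (of_real ((Im a)\<^sup>2 - t * (Re b)\<^sup>2 - t * (Im b)\<^sup>2)))"

definition spectral_form :: "real \<Rightarrow> hypercomplex \<Rightarrow> complex^2^2" where
  "spectral_form t h =
     vector [vector [spectral_value t h, 0],
             vector [0, cnj (spectral_value t h)]]"

(* For U in H2 t, invertibility as a complex matrix is the same as invertibility inside H2 t:
   the determinant of U is real, so its inverse again lies in H2 t (matrix_inv_in_H2). *)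
definition similar_in_H2 :: "real \<Rightarrow> complex^2^2 \<Rightarrow> complex^2^2 \<Rightarrow> bool" where
  "similar_in_H2 t A B \<longleftrightarrow>
     A \<in> H2 t \<and> B \<in> H2 t \<and>
     (\<exists>U \<in> H2 t. invertible U \<and> B = matrix_inv U ** A ** U)"

definition hyp_similar :: "real \<Rightarrow> hypercomplex \<Rightarrow> hypercomplex \<Rightarrow> bool" where
  "hyp_similar t h k \<longleftrightarrow> similar_in_H2 t (realization t h) (realization t k)"

lemma realization_mult:
  "realization t (hyp_mult t h k) = realization t h ** realization t k"
  by (simp add: realization_def hyp_mult_def matrix_matrix_mult_def vec_eq_iff forall_2 sum_2
      algebra_simps)

lemma spectral_form_eq_realization:
  "spectral_form t h = realization t (spectral_value t h, 0)"
  by (simp add: spectral_form_def realization_def)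

lemma spectral_value_neg:
  assumes "t < 0" and "b \<noteq> 0"
  shows "spectral_value t (a, b) =
           Complex (Re a) (sqrt ((Im a)\<^sup>2 - t * (Re b)\<^sup>2 - t * (Im b)\<^sup>2))"
proof -
  have "t * (Re b)\<^sup>2 \<le> 0" "t * (Im b)\<^sup>2 \<le> 0"
    using assms(1) by (simp_all add: mult_nonpos_nonneg)
  then have "(Im a)\<^sup>2 - t * (Re b)\<^sup>2 - t * (Im b)\<^sup>2 \<ge> 0"
    using zero_le_power2[of "Im a"] by linarith
  then show ?thesis
    using assms(2) by (simp only: spectral_value_def csqrt_of_real_nonneg Let_def fst_conv
        snd_conv if_False complex_eq_iff) simp
qed

lemma matrix_inv_in_H2:
  assumes "U \<in> H2 t" and "invertible U"
  shows "matrix_inv U \<in> H2 t"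
proof -
  obtain a b where U: "U = realization t (a, b)"
    using assms(1) by (auto simp: H2_def)
  define d where "d = (cmod a)\<^sup>2 - t * (cmod b)\<^sup>2"
  have d: "of_real d = a * cnj a - of_real t * b * cnj b"
    by (simp only: d_def of_real_diff of_real_mult complex_norm_square mult.assoc)
  have "det U = of_real d"
    by (simp add: U d realization_def det_2)
  then have d0: "complex_of_real d \<noteq> 0"
    using assms(2) by (simp add: invertible_det_nz)
  define V where "V = realization t (cnj a / of_real d, - b / of_real d)"
  have UV: "U ** V = mat 1"
    using d0 by (simp add: U V_def realization_def matrix_matrix_mult_def mat_def vec_eq_iff
        forall_2 sum_2 diff_divide_distrib[symmetric] add_divide_distrib[symmetric])
      (simp add: d algebra_simps)
  have "matrix_inv U = matrix_inv U ** (U ** V)"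
    by (simp add: UV)
  also have "\<dots> = V"
    using someI_ex[OF assms(2)[unfolded invertible_def]] by (simp add: matrix_mul_assoc matrix_inv_def)
  finally show ?thesis
    by (simp add: V_def H2_def)
qed

end

theory Submission
  imports Defs
begin

text \<open>
  An element \<open>h = (a, b)\<close> of the algebra with \<open>a = x + \<i>y\<close> splits as a real number \<open>x\<close> plus a
  pure part \<open>q = (\<i>y, b)\<close>, whose square is the real number \<open>-s\<^sup>2\<close> with
  \<open>s\<^sup>2 = y\<^sup>2 - t * \<bar>b\<bar>\<^sup>2\<close>. The spectral value is \<open>x + \<i>s\<close>, with the pure part \<open>k = (\<i>s, 0)\<close>, which has the
  same square. Two elements with a common real square are intertwined by their sum:
  \<open>q(q + k) = -s\<^sup>2 + qk = (q + k)k\<close>. Since \<open>x\<close> is central, \<open>q + k = (\<i>(y + s), b)\<close> also intertwines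
  \<open>h\<close> with its spectral value. The determinant of its realization is
  \<open>(y + s)\<^sup>2 - t * \<bar>b\<bar>\<^sup>2\<close>, which is positive when \<open>t < 0\<close> and \<open>b \<noteq> 0\<close>, so conjugation by
  \<open>q + k\<close> is a similarity. When \<open>b = 0\<close> the element is its own spectral value and the identity
  conjugates; the sum \<open>q + k\<close> would not do there, because it is zero for \<open>y = 0\<close>.
\<close>

lemma det_realization:
  "det (realization t u) = of_real ((cmod (fst u))\<^sup>2 - t * (cmod (snd u))\<^sup>2)"
  by (simp only: of_real_diff of_real_mult complex_norm_square)
    (simp add: realization_def det_2)

text \<open>
  Similarity asks for a conjugation by an inverse matrix. An intertwining element of nonzero
  norm suffices, which reduces the question to the multiplication of the algebra.
\<close>

lemma hyp_similar_if_intertwined: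
  assumes intertwines: "hyp_mult t h u = hyp_mult t u k"
    and nonzero: "(cmod (fst u))\<^sup>2 - t * (cmod (snd u))\<^sup>2 \<noteq> 0"
  shows "hyp_similar t h k"
proof -
  let ?U = "realization t u"
  have inv: "invertible ?U"
    using nonzero by (simp only: invertible_det_nz det_realization of_real_eq_0_iff not_False_eq_True)
  then have left_inv: "matrix_inv ?U ** ?U = mat 1"
    unfolding invertible_def matrix_inv_def by (rule someI2_ex) simp
  have "matrix_inv ?U ** realization t h ** ?U = matrix_inv ?U ** (?U ** realization t k)"
    by (simp add: intertwines flip: matrix_mul_assoc realization_mult)
  also have "\<dots> = realization t k"
    by (simp add: matrix_mul_assoc left_inv)
  finally show ?thesis
    unfolding hyp_similar_def similar_in_H2_def H2_def using inv by (metis rangeI)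
qed

lemma hyp_similar_refl: "hyp_similar t h h"
  by (rule hyp_similar_if_intertwined[where u = "(1, 0)"]) (simp_all add: hyp_mult_def)

lemma spectral_intertwiner:
  fixes t s :: real and a b :: complex
  assumes "s\<^sup>2 = (Im a)\<^sup>2 - t * (Re b)\<^sup>2 - t * (Im b)\<^sup>2"
  shows "hyp_mult t (a, b) (Complex 0 (Im a + s), b) =
    hyp_mult t (Complex 0 (Im a + s), b) (Complex (Re a) s, 0)"
  using assms by (simp add: hyp_mult_def complex_eq_iff algebra_simps power2_eq_square)

lemma hyp_similar_spectral_value:
  assumes "t < 0"
  shows "hyp_similar t h (spectral_value t h, 0)"
proof (cases "snd h = 0")
  case True
  then have "(spectral_value t h, 0) = h"
    by (simp add: spectral_value_def prod_eq_iff)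
  then show ?thesis
    by (simp add: hyp_similar_refl)
next
  case False
  obtain a b where h: "h = (a, b)"
    by (cases h)
  with False have b: "b \<noteq> 0"
    by simp
  define s where "s = sqrt ((Im a)\<^sup>2 - t * (Re b)\<^sup>2 - t * (Im b)\<^sup>2)"
  have "t * (Re b)\<^sup>2 \<le> 0" "t * (Im b)\<^sup>2 \<le> 0"
    using assms by (simp_all add: mult_nonpos_nonneg)
  then have "(Im a)\<^sup>2 - t * (Re b)\<^sup>2 - t * (Im b)\<^sup>2 \<ge> 0"
    using zero_le_power2[of "Im a"] by linarith
  then have s: "s\<^sup>2 = (Im a)\<^sup>2 - t * (Re b)\<^sup>2 - t * (Im b)\<^sup>2"
    by (simp add: s_def)
  have "t * (cmod b)\<^sup>2 < 0"
    using assms b by (simp add: mult_neg_pos)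
  then have nonzero: "(cmod (Complex 0 (Im a + s)))\<^sup>2 - t * (cmod b)\<^sup>2 \<noteq> 0"
    using zero_le_power2[of "cmod (Complex 0 (Im a + s))"] by linarith
  have "hyp_similar t h (Complex (Re a) s, 0)"
    unfolding h
    by (rule hyp_similar_if_intertwined[OF spectral_intertwiner[OF s]]) (use nonzero in simp)
  then show ?thesis
    by (simp add: h spectral_value_neg[OF assms b] s_def)
qed

theorem theorem40:
  fixes t :: real and h :: hypercomplex
  assumes "t < 0"
  shows "hyp_similar t h (spectral_value t h, 0) \<and>
         similar_in_H2 t (realization t h) (spectral_form t h)"
  using hyp_similar_spectral_value[OF assms, of h]
  by (simp add: hyp_similar_def spectral_form_eq_realization)

end
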